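(* Let $n\ge 1$, $\sigma>0$, and let $\boldsymbol{\varepsilon}=(\varepsilon_1,\dots,\varepsilon_n)$ with $0\le \varepsilon_1\le\varepsilon_2\le\dots\le\varepsilon_n$ be a privacy vector. Let $\mathfrak{N}_\sigma=\{\mathcal{N}(\mu,\sigma^2):\mu\in\mathbb{R}\}$. For $D\sim\mathcal{N}(\mu,\sigma^2)^n$ (i.e. $D=(x_1,\dots,x_n)$ with $x_i$ i.i.d. $\mathcal{N}(\mu,\sigma^2)$), \[ \inf_{\mathcal{M}}\ \sup_{\mathcal{N}(\mu,\sigma^2)\in\mathfrak{N}_\sigma}\ \Pr\left(|\mathcal{M}(D)-\mu|\ \ge\ \max_{k=1,2,\dots,n}\frac{1}{\sqrt2}\,\frac{\sigma}{\sum_{i=1}^k\varepsilon_i+2\sqrt{n-k}}\right)\ \ge\ \frac14, \] where the infimum is over all real-valued mechanisms $\mathcal{M}$ satisfying $\boldsymbol{\varepsilon}$-PDP (bounded setting), and the probability is over both $D$ and the randomness of $\mathcal{M}$.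
   Context: Bounded personalized differential privacy (PDP): datasets are vectors $D=(x_1,\dots,x_n)\in\mathbb{R}^n$ and the privacy vector $\boldsymbol{\varepsilon}=(\varepsilon_1,\dots,\varepsilon_n)\ge 0$ is public, $\varepsilon_i$ being the budget of the $i$-th record. Write $D\sim_i D'$ if $D,D'$ differ only in the $i$-th entry. A randomized mechanism $\mathcal{M}$ satisfies $\boldsymbol{\varepsilon}$-PDP if for every $i\in\{1,\dots,n\}$, all $D\sim_i D'$ and all measurable sets $K$ of outputs, $\Pr(\mathcal{M}(D)\in K)\le e^{\varepsilon_i}\Pr(\mathcal{M}(D')\in K)$.
   Formalization: If all ε_i are 0, the k = n term of the maximum is σ/0, which is undefined (and read as +∞ makes the claim false); the formal statement gives this term the value 0, so it drops out of the maximum. *)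

theory Defs
  imports "HOL-Probability.Probability"
begin

text \<open>
  Datasets in \<open>\<real>\<^sup>n\<close> are the points of the product Borel space over the index set
  \<open>{1..n}\<close>, i.e. functions on \<open>{1..n}\<close> that are \<open>undefined\<close> elsewhere.
\<close>

definition data_space :: "nat \<Rightarrow> (nat \<Rightarrow> real) measure" where
  "data_space n = (\<Pi>\<^sub>M i\<in>{1..n}. borel)"

text \<open>
  \<open>D\<close> and \<open>D'\<close> agree outside entry \<open>i\<close>. The case \<open>D = D'\<close> is included; it imposes nothing
  on a mechanism because budgets are non-negative.
\<close>

definition neighbours :: "nat \<Rightarrow> nat \<Rightarrow> (nat \<Rightarrow> real) \<Rightarrow> (nat \<Rightarrow> real) \<Rightarrow> bool" where
  "neighbours n i D D' \<longleftrightarrow>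
     D \<in> space (data_space n) \<and> D' \<in> space (data_space n) \<and> (\<forall>j\<in>{1..n} - {i}. D j = D' j)"

text \<open>
  A randomized mechanism with output space \<open>R\<close> is a Markov kernel: \<open>M D\<close> is the law of the
  output on dataset \<open>D\<close>.
\<close>

definition mechanisms :: "nat \<Rightarrow> 'a measure \<Rightarrow> ((nat \<Rightarrow> real) \<Rightarrow> 'a measure) set" where
  "mechanisms n R = data_space n \<rightarrow>\<^sub>M prob_algebra R"

definition PDP_mechanisms ::
  "nat \<Rightarrow> (nat \<Rightarrow> real) \<Rightarrow> 'a measure \<Rightarrow> ((nat \<Rightarrow> real) \<Rightarrow> 'a measure) set" where
  "PDP_mechanisms n \<epsilon> R =
     {M \<in> mechanisms n R.
        \<forall>i\<in>{1..n}. \<forall>D D'. neighbours n i D D' \<longrightarrow>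
          (\<forall>K\<in>sets R. measure (M D) K \<le> exp (\<epsilon> i) * measure (M D') K)}"

text \<open>\<open>\<sigma>\<close> is the standard deviation, as in \<^const>\<open>normal_density\<close>.\<close>

definition normal_law :: "real \<Rightarrow> real \<Rightarrow> real measure" where
  "normal_law \<mu> \<sigma> = density lborel (\<lambda>x. ennreal (normal_density \<mu> \<sigma> x))"

definition iid_normal :: "nat \<Rightarrow> real \<Rightarrow> real \<Rightarrow> (nat \<Rightarrow> real) measure" where
  "iid_normal n \<mu> \<sigma> = (\<Pi>\<^sub>M i\<in>{1..n}. normal_law \<mu> \<sigma>)"

text \<open>
  The law of the output when the dataset is itself drawn from \<open>P\<close>, so probabilities under it
  are over both the data and the randomness of the mechanism.
\<close>

definition output_law ::
  "(nat \<Rightarrow> real) measure \<Rightarrow> ((nat \<Rightarrow> real) \<Rightarrow> 'a measure) \<Rightarrow> 'a measure" where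
  "output_law P M = P \<bind> M"

text \<open>
  A denominator vanishes only for \<open>k = n\<close> with all budgets zero; since division by zero
  yields zero, that term then does not contribute to the maximum.
\<close>

definition error_threshold :: "nat \<Rightarrow> real \<Rightarrow> (nat \<Rightarrow> real) \<Rightarrow> real" where
  "error_threshold n \<sigma> \<epsilon> =
     (MAX k\<in>{1..n}. 1 / sqrt 2 * (\<sigma> / ((\<Sum>i=1..k. \<epsilon> i) + 2 * sqrt (real (n - k)))))"

end

theory Submission
  imports Defs
begin

section \<open>From multiplicative privacy to an additive bound\<close>

text \<open>\<open>artanh y - y\<close> vanishes at 0 and has derivative
  \<open>1 / (1 - y\<^sup>2) - 1\<close>, which is nonnegative on \<open>[0, x]\<close>. Its use is
  to replace the hyperbolic bound \<open>tanh (e / 2)\<close> on a difference of probabilities by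
  the linear one \<open>e / 2\<close>.\<close>

lemma le_artanh:
  fixes x :: real
  assumes "0 \<le> x" "x < 1"
  shows "x \<le> artanh x"
proof -
  have "artanh 0 - 0 \<le> artanh x - x"
  proof (rule DERIV_nonneg_imp_nondecreasing[OF assms(1)])
    fix y :: real
    assume y: "0 \<le> y" "y \<le> x"
    then have "y\<^sup>2 < 1"
      using assms by (simp add: abs_square_less_1)
    then have "0 \<le> 1 / (1 - y\<^sup>2) - 1"
      by (simp add: field_simps)
    moreover have "((\<lambda>y. artanh y - y) has_real_derivative 1 / (1 - y\<^sup>2) - 1) (at y)"
      using y assms by (auto intro!: derivative_eq_intros)
    ultimately show "\<exists>d. ((\<lambda>y. artanh y - y) has_real_derivative d) (at y) \<and> 0 \<le> d"
      by blast
  qed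
  then show ?thesis by simp
qed

text \<open>The hypotheses are the privacy inequality for an event and, with the roles swapped, for
  its complement. Adding them gives \<open>1 + d \<le> exp e * (1 - d)\<close> for
  \<open>d = a - b\<close>, that is \<open>artanh d \<le> e / 2\<close>. Using both is what gains
  the factor 1/2 in front of the budget.\<close>

lemma indistinguishable_imp_diff_le:
  fixes a b e :: real
  assumes "0 \<le> e" "a \<le> exp e * b" "1 - b \<le> exp e * (1 - a)"
  shows "a - b \<le> e / 2"
proof (cases "a \<le> b")
  case True
  then show ?thesis using assms(1) by simp
next
  case False
  define d where "d = a - b"
  have d: "0 \<le> d" using False by (simp add: d_def)
  have *: "1 + d \<le> exp e * (1 - d)"
    using assms(2,3) by (simp add: d_def algebra_simps)
  then have "0 < exp e * (1 - d)" using d by linarith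
  then have d1: "d < 1" by (simp add: zero_less_mult_iff)
  then have "(1 + d) / (1 - d) \<le> exp e"
    using * by (simp add: divide_simps)
  then have "ln ((1 + d) / (1 - d)) \<le> e"
    using d d1 by (metis add_pos_nonneg diff_gt_0_iff_gt divide_pos_pos less_numeral_extra(1) ln_exp ln_mono)
  then have "artanh d \<le> e / 2"
    by (simp add: artanh_def)
  then show ?thesis
    using le_artanh[OF d d1] by (simp add: d_def)
qed

section \<open>Le Cam's inequality for a bounded test function\<close>

text \<open>
  Le Cam's bound of total variation by the Hellinger affinity, for a test function of
  oscillation at most \<open>\<delta>\<close>. In place of Cauchy-Schwarz, \<open>\<bar>L - 1\<bar> = \<bar>\<surd>L - 1\<bar> (\<surd>L + 1)\<close>
  is split by AM-GM with weight \<open>c = (1 + B) / r\<close>, where \<open>B = \<integral>\<surd>L\<close>.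
\<close>

lemma (in prob_space) integral_likelihood_diff_le:
  fixes L \<phi> :: "'a \<Rightarrow> real"
  assumes L [measurable]: "integrable M L" and L0: "\<And>x. x \<in> space M \<Longrightarrow> 0 \<le> L x"
    and L1: "expectation L = 1"
    and \<phi> [measurable]: "\<phi> \<in> borel_measurable M"
    and bnd: "\<And>x. x \<in> space M \<Longrightarrow> a \<le> \<phi> x" "\<And>x. x \<in> space M \<Longrightarrow> \<phi> x \<le> a + \<delta>"
    and r: "0 < r" "1 - (expectation (\<lambda>x. sqrt (L x)))\<^sup>2 \<le> r\<^sup>2"
  shows "\<bar>expectation (\<lambda>x. L x * \<phi> x) - expectation \<phi>\<bar> \<le> \<delta> * r"
proof -
  obtain z where "z \<in> space M" using not_empty by blast
  then have \<delta>: "0 \<le> \<delta>" using bnd[of z] by linarith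
  define B where "B = expectation (\<lambda>x. sqrt (L x))"
  define c where "c = (1 + B) / r"
  \<comment> \<open>The midpoint of the range allowed for \<open>\<phi>\<close>. As
    \<open>L - 1\<close> has expectation 0, replacing \<open>\<phi>\<close> by
    \<open>\<phi> - m\<close> leaves the difference unchanged, while its absolute value drops to at
    most \<open>\<delta> / 2\<close>.\<close>
  define m where "m = a + \<delta> / 2"
  have B0: "0 \<le> B"
    unfolding B_def using L0 by (intro Bochner_Integration.integral_nonneg) auto
  then have c: "0 < c" using r by (simp add: c_def)
  have Lm [measurable]: "L \<in> borel_measurable M" using L by simp
  have sqrtL: "integrable M (\<lambda>x. sqrt (L x))"
  proof (rule Bochner_Integration.integrable_bound)
    show "integrable M (\<lambda>x. L x + 1)" using L by simp
    have "sqrt (L x) \<le> L x + 1" if "x \<in> space M" for x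
      using L0[OF that]
      by (intro real_le_lsqrt) (auto simp: power2_eq_square algebra_simps)
    then show "AE x in M. norm (sqrt (L x)) \<le> norm (L x + 1)"
      using L0 by (intro AE_I2) auto
  qed simp
  have \<phi>i: "integrable M \<phi>"
    using bnd by (intro integrable_const_bound[where B = "\<bar>a\<bar> + \<bar>\<delta>\<bar>"] AE_I2) (auto, smt (verit))
  have L\<phi>i: "integrable M (\<lambda>x. L x * \<phi> x)"
  proof (rule Bochner_Integration.integrable_bound)
    show "integrable M (\<lambda>x. L x * (\<bar>a\<bar> + \<bar>\<delta>\<bar>))" using L by simp
    have "\<bar>\<phi> x\<bar> \<le> \<bar>a\<bar> + \<bar>\<delta>\<bar>" if "x \<in> space M" for x
      using bnd[OF that] by linarith
    then show "AE x in M. norm (L x * \<phi> x) \<le> norm (L x * (\<bar>a\<bar> + \<bar>\<delta>\<bar>))"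
      using L0 by (intro AE_I2) (auto simp: abs_mult intro!: mult_left_mono)
  qed simp
  have "expectation (\<lambda>x. L x * \<phi> x) - expectation \<phi>
      = expectation (\<lambda>x. L x * \<phi> x - \<phi> x - (m * L x - m))"
    using \<phi>i L\<phi>i L L1 by (simp add: prob_space)
  also have "\<bar>\<dots>\<bar> \<le> expectation (\<lambda>x. \<bar>L x * \<phi> x - \<phi> x - (m * L x - m)\<bar>)"
    by (rule integral_abs_bound)
  also have "\<dots> \<le> expectation (\<lambda>x. \<delta> / 4 * (c * (L x + 1 - 2 * sqrt (L x)) + (L x + 1 + 2 * sqrt (L x)) / c))"
  proof (rule integral_mono)
    fix x assume x: "x \<in> space M"
    define s where "s = sqrt (L x)"
    have s: "0 \<le> s" "L x = s\<^sup>2" using L0[OF x] by (auto simp: s_def)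
    \<comment> \<open>Weighted AM-GM for \<open>c * \<bar>s - 1\<bar>\<close> and
      \<open>s + 1\<close>, written as a square divided by \<open>c\<close> so that both squares are
      linear in \<open>L x\<close> and \<open>s\<close> and can be integrated.\<close>
    have "0 \<le> (c * \<bar>s - 1\<bar> - (s + 1))\<^sup>2 / c" using c by simp
    also have "\<dots> = c * (s - 1)\<^sup>2 + (s + 1)\<^sup>2 / c - 2 * (\<bar>s - 1\<bar> * (s + 1))"
      using c by (simp add: field_simps power2_eq_square)
    also have "\<bar>s - 1\<bar> * (s + 1) = \<bar>L x - 1\<bar>"
    proof -
      have "L x - 1 = (s - 1) * (s + 1)" by (simp add: s(2) power2_eq_square algebra_simps)
      then show ?thesis using s(1) by (simp add: abs_mult)
    qed
    finally have 1: "\<bar>L x - 1\<bar> \<le> (c * (s - 1)\<^sup>2 + (s + 1)\<^sup>2 / c) / 2" by simp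
    have "L x * \<phi> x - \<phi> x - (m * L x - m) = (\<phi> x - m) * (L x - 1)"
      by (simp add: algebra_simps)
    then have "\<bar>L x * \<phi> x - \<phi> x - (m * L x - m)\<bar> = \<bar>\<phi> x - m\<bar> * \<bar>L x - 1\<bar>"
      by (simp add: abs_mult)
    also have "\<dots> \<le> (\<delta> / 2) * ((c * (s - 1)\<^sup>2 + (s + 1)\<^sup>2 / c) / 2)"
    proof (rule mult_mono[OF _ 1])
      show "\<bar>\<phi> x - m\<bar> \<le> \<delta> / 2" using bnd[OF x] by (auto simp: m_def abs_le_iff field_simps)
    qed (use \<delta> in auto)
    also have "\<dots> = \<delta> / 4 * (c * (L x + 1 - 2 * s) + (L x + 1 + 2 * s) / c)"
    proof -
      have "(s - 1)\<^sup>2 = L x + 1 - 2 * s" "(s + 1)\<^sup>2 = L x + 1 + 2 * s"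
        by (simp_all add: s(2) power2_eq_square algebra_simps)
      then show ?thesis by simp
    qed
    finally show "\<bar>L x * \<phi> x - \<phi> x - (m * L x - m)\<bar>
        \<le> \<delta> / 4 * (c * (L x + 1 - 2 * sqrt (L x)) + (L x + 1 + 2 * sqrt (L x)) / c)"
      by (simp add: s_def)
  qed (use \<phi>i L\<phi>i L sqrtL in auto)
  also have "\<dots> = \<delta> / 2 * (c * (1 - B) + (1 + B) / c)"
    using L sqrtL L1 by (simp add: prob_space B_def algebra_simps add_divide_distrib)
  \<comment> \<open>The weight is chosen so that the second term is exactly \<open>r\<close>; the
    first is at most \<open>r\<close> by the hypothesis on the affinity. For
    \<open>r\<^sup>2 = 1 - B\<^sup>2\<close> this is the value that Cauchy-Schwarz gives.\<close>
  also have "c * (1 - B) + (1 + B) / c = (1 - B\<^sup>2) / r + r"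
  proof (rule arg_cong2[where f = "(+)"])
    show "c * (1 - B) = (1 - B\<^sup>2) / r"
      by (simp add: c_def power2_eq_square algebra_simps)
    show "(1 + B) / c = r" using r B0 by (simp add: c_def)
  qed
  also have "\<delta> / 2 * ((1 - B\<^sup>2) / r + r) \<le> \<delta> / 2 * (2 * r)"
    using r \<delta> by (intro mult_left_mono) (simp_all add: B_def divide_simps power2_eq_square)
  finally show ?thesis by simp
qed

section \<open>Densities of finite products\<close>

text \<open>On a box both the density and the indicator factor over the coordinates, so the integral
  is a product of one-dimensional integrals. Sigma-finiteness of the weighted factors lets agreement
  on boxes determine the product measure.\<close>

lemma PiM_density:
  fixes f :: "'i \<Rightarrow> 'a \<Rightarrow> ennreal"
  assumes "finite I" and M: "\<And>i. sigma_finite_measure (M i)"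
    and fM: "\<And>i. sigma_finite_measure (density (M i) (f i))"
    and f [measurable]: "\<And>i. f i \<in> borel_measurable (M i)"
  shows "PiM I (\<lambda>i. density (M i) (f i)) = density (PiM I M) (\<lambda>x. \<Prod>i\<in>I. f i (x i))"
proof -
  interpret M: product_sigma_finite M
    using M by unfold_locales (auto simp: sigma_finite_measure_def)
  interpret fM: product_sigma_finite "\<lambda>i. density (M i) (f i)"
    using fM by (simp add: product_sigma_finite_def)
  show ?thesis
  proof (rule fM.PiM_eqI[symmetric, OF \<open>finite I\<close>])
    show "sets (density (PiM I M) (\<lambda>x. \<Prod>i\<in>I. f i (x i))) = sets (PiM I (\<lambda>i. density (M i) (f i)))"
      by (simp cong: sets_PiM_cong)
    fix A assume A: "\<And>i. i \<in> I \<Longrightarrow> A i \<in> sets (density (M i) (f i))"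
    then have [measurable]: "Pi\<^sub>E I A \<in> sets (PiM I M)"
      using \<open>finite I\<close> by (intro sets_PiM_I_finite) auto
    have "emeasure (density (PiM I M) (\<lambda>x. \<Prod>i\<in>I. f i (x i))) (Pi\<^sub>E I A)
        = (\<integral>\<^sup>+x. (\<Prod>i\<in>I. f i (x i)) * indicator (Pi\<^sub>E I A) x \<partial>PiM I M)"
      by (rule emeasure_density) measurable
    also have "\<dots> = (\<integral>\<^sup>+x. (\<Prod>i\<in>I. f i (x i) * indicator (A i) (x i)) \<partial>PiM I M)"
    proof (rule nn_integral_cong)
      fix x assume "x \<in> space (PiM I M)"
      \<comment> \<open>Membership in a box also demands the value \<open>undefined\<close> outside
        \<open>I\<close>, so the indicator factors only for extensional \<open>x\<close>.\<close>
      then have "x \<in> extensional I" by (auto simp: space_PiM PiE_def)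
      then have "indicator (Pi\<^sub>E I A) x = (\<Prod>i\<in>I. indicator (A i) (x i) :: ennreal)"
        using \<open>finite I\<close> by (auto simp: indicator_def PiE_def Pi_def prod_eq_1_iff)
      then show "(\<Prod>i\<in>I. f i (x i)) * indicator (Pi\<^sub>E I A) x
          = (\<Prod>i\<in>I. f i (x i) * indicator (A i) (x i))"
        by (simp add: prod.distrib)
    qed
    also have "\<dots> = (\<Prod>i\<in>I. \<integral>\<^sup>+x. f i x * indicator (A i) x \<partial>M i)"
      using A by (intro M.product_nn_integral_prod \<open>finite I\<close>) simp
    also have "\<dots> = (\<Prod>i\<in>I. emeasure (density (M i) (f i)) (A i))"
      using A by (intro prod.cong refl) (simp add: emeasure_density)
    finally show "emeasure (density (PiM I M) (\<lambda>x. \<Prod>i\<in>I. f i (x i))) (Pi\<^sub>E I A)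
      = (\<Prod>i\<in>I. emeasure (density (M i) (f i)) (A i))" .
  qed
qed

section \<open>Gaussian likelihood ratios and their Hellinger affinity\<close>

text \<open>The likelihood ratio of N(\<nu>, \<sigma>^2) to N(\<mu>, \<sigma>^2): the terms
  quadratic in \<open>x\<close> cancel in the quotient of the densities, leaving an exponential of
  an affine function.\<close>

definition normal_ratio :: "real \<Rightarrow> real \<Rightarrow> real \<Rightarrow> real \<Rightarrow> real" where
  "normal_ratio \<sigma> \<mu> \<nu> x = exp (((\<nu> - \<mu>) * (x - \<mu>) - (\<nu> - \<mu>)\<^sup>2 / 2) / \<sigma>\<^sup>2)"

lemma normal_ratio_pos [simp]: "0 < normal_ratio \<sigma> \<mu> \<nu> x" "0 \<le> normal_ratio \<sigma> \<mu> \<nu> x"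
  by (auto simp: normal_ratio_def)

lemma measurable_normal_ratio [measurable]: "normal_ratio \<sigma> \<mu> \<nu> \<in> borel_measurable borel"
  unfolding normal_ratio_def[abs_def] by measurable

lemma sets_normal_law [simp, measurable_cong]: "sets (normal_law \<mu> \<sigma>) = sets borel"
  by (simp add: normal_law_def)

lemma space_normal_law [simp]: "space (normal_law \<mu> \<sigma>) = UNIV"
  by (simp add: normal_law_def)

lemma prob_space_normal_law: "0 < \<sigma> \<Longrightarrow> prob_space (normal_law \<mu> \<sigma>)"
  unfolding normal_law_def by (rule prob_space_normal_density)

lemma normal_density_shift:
  assumes "0 < \<sigma>"
  shows "normal_density \<mu> \<sigma> x * normal_ratio \<sigma> \<mu> \<nu> x = normal_density \<nu> \<sigma> x"
  using assms unfolding normal_density_def normal_ratio_def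
  by (simp add: exp_add[symmetric] field_simps power2_eq_square)

text \<open>Halving the affine exponent gives, up to a constant, the ratio towards the midpoint of
  the two means. Since every such ratio integrates to 1, that constant is the Hellinger
  affinity.\<close>

lemma sqrt_normal_ratio:
  assumes "0 < \<sigma>"
  shows "sqrt (normal_ratio \<sigma> \<mu> \<nu> x)
    = exp (- (\<nu> - \<mu>)\<^sup>2 / (8 * \<sigma>\<^sup>2)) * normal_ratio \<sigma> \<mu> ((\<mu> + \<nu>) / 2) x"
  using assms unfolding normal_ratio_def
  by (intro real_sqrt_unique)
    (auto simp: exp_add[symmetric] exp_double[symmetric] field_simps power2_eq_square)

lemma density_normal_ratio:
  assumes "0 < \<sigma>"
  shows "density (normal_law \<mu> \<sigma>) (\<lambda>x. ennreal (normal_ratio \<sigma> \<mu> \<nu> x)) = normal_law \<nu> \<sigma>"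
  unfolding normal_law_def
  by (simp add: density_density_eq ennreal_mult[symmetric] normal_density_shift[OF assms])

lemma integral_normal_ratio:
  assumes "0 < \<sigma>"
  shows "integrable (normal_law \<mu> \<sigma>) (normal_ratio \<sigma> \<mu> \<nu>)"
    and "integral\<^sup>L (normal_law \<mu> \<sigma>) (normal_ratio \<sigma> \<mu> \<nu>) = 1"
  using assms unfolding normal_law_def
  by (simp_all add: integrable_density integral_density normal_density_shift)

lemma integral_sqrt_normal_ratio:
  assumes "0 < \<sigma>"
  shows "integrable (normal_law \<mu> \<sigma>) (\<lambda>x. sqrt (normal_ratio \<sigma> \<mu> \<nu> x))"
    and "(\<integral>x. sqrt (normal_ratio \<sigma> \<mu> \<nu> x) \<partial>normal_law \<mu> \<sigma>) = exp (- (\<nu> - \<mu>)\<^sup>2 / (8 * \<sigma>\<^sup>2))"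
  using integral_normal_ratio[OF assms] by (simp_all add: sqrt_normal_ratio[OF assms])

text \<open>Supplies the radius \<open>r\<close> for \<open>integral_likelihood_diff_le\<close>,
  with \<open>S\<close> the squared Euclidean length of the mean shift. The squared affinity is
  \<open>exp (- S / (4 * \<sigma>\<^sup>2))\<close>, and 1 - exp(-u) is at most u.\<close>

lemma one_minus_normal_affinity_le:
  assumes "0 < \<sigma>" "0 \<le> S"
  shows "1 - (exp (- S / (8 * \<sigma>\<^sup>2)))\<^sup>2 \<le> (sqrt S / (2 * \<sigma>))\<^sup>2"
proof -
  have "(exp (- S / (8 * \<sigma>\<^sup>2)))\<^sup>2 = exp (- (S / (4 * \<sigma>\<^sup>2)))"
    by (simp add: exp_double[symmetric])
  moreover have "(sqrt S / (2 * \<sigma>))\<^sup>2 = S / (4 * \<sigma>\<^sup>2)"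
    using assms by (simp add: power_divide power_mult_distrib)
  ultimately show ?thesis
    using exp_ge_add_one_self[of "- (S / (4 * \<sigma>\<^sup>2))"] by linarith
qed

lemma sqrt_prod: "finite I \<Longrightarrow> sqrt (\<Prod>i\<in>I. f i) = (\<Prod>i\<in>I. sqrt (f i))"
  by (induction I rule: finite_induct) (simp_all add: real_sqrt_mult)

section \<open>Shifting Gaussian means in one record or in several\<close>

text \<open>Le Cam's bound for a single record. Privacy controls only the oscillation of
  \<open>\<phi>\<close> in that record, so the infimum of \<open>\<phi>\<close> serves as the lower
  end \<open>a\<close> of its range.\<close>

lemma normal_law_diff_le:
  fixes \<phi> :: "real \<Rightarrow> real"
  assumes "0 < \<sigma>" and [measurable]: "\<phi> \<in> borel_measurable borel"
    and osc: "\<And>x y. \<phi> x - \<phi> y \<le> \<delta>"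
  shows "\<bar>integral\<^sup>L (normal_law \<nu> \<sigma>) \<phi> - integral\<^sup>L (normal_law \<mu> \<sigma>) \<phi>\<bar> \<le> \<delta> * (\<bar>\<nu> - \<mu>\<bar> / (2 * \<sigma>))"
\<comment> \<open>Equal means are split off because the radius \<open>r\<close> has to be
  positive.\<close>
proof (cases "\<nu> = \<mu>")
  case False
  interpret prob_space "normal_law \<mu> \<sigma>" using assms(1) by (rule prob_space_normal_law)
  have lb: "bdd_below (range \<phi>)"
    using osc[of 0] by (intro bdd_belowI[where m = "\<phi> 0 - \<delta>"]) (auto simp: algebra_simps)
  have eq: "integral\<^sup>L (normal_law \<nu> \<sigma>) \<phi> = expectation (\<lambda>x. normal_ratio \<sigma> \<mu> \<nu> x * \<phi> x)"
    unfolding density_normal_ratio[OF assms(1), of \<mu> \<nu>, symmetric] by (simp add: integral_density)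
  have "\<phi> x - \<delta> \<le> (INF y. \<phi> y)" for x
    using osc[of x] by (intro cINF_greatest) (auto simp: algebra_simps)
  then have ub: "\<phi> x \<le> (INF y. \<phi> y) + \<delta>" for x
    by (simp add: algebra_simps)
  show ?thesis
    unfolding eq
  proof (rule integral_likelihood_diff_le[where a = "INF y. \<phi> y"])
    show "1 - (expectation (\<lambda>x. sqrt (normal_ratio \<sigma> \<mu> \<nu> x)))\<^sup>2 \<le> (\<bar>\<nu> - \<mu>\<bar> / (2 * \<sigma>))\<^sup>2"
      using one_minus_normal_affinity_le[OF assms(1), of "(\<nu> - \<mu>)\<^sup>2"]
      by (simp add: integral_sqrt_normal_ratio[OF assms(1)])
  qed (use False assms(1) lb ub in \<open>auto simp: integral_normal_ratio intro: cINF_lower\<close>)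
qed simp

text \<open>Affinities multiply over independent records, so the squared shifts add up in the
  exponent. The cost is therefore the Euclidean length of the shift, which produces the square root
  of the number of moved records.\<close>

lemma PiM_normal_law_diff_le:
  fixes \<phi> :: "('i \<Rightarrow> real) \<Rightarrow> real"
  assumes "0 < \<sigma>" "finite I"
    and \<phi> [measurable]: "\<phi> \<in> borel_measurable (PiM I (\<lambda>_. borel))"
    and bnd: "\<And>x. x \<in> space (PiM I (\<lambda>_. borel)) \<Longrightarrow> a \<le> \<phi> x"
      "\<And>x. x \<in> space (PiM I (\<lambda>_. borel)) \<Longrightarrow> \<phi> x \<le> a + \<delta>"
  shows "\<bar>integral\<^sup>L (PiM I (\<lambda>i. normal_law (\<nu> i) \<sigma>)) \<phi> - integral\<^sup>L (PiM I (\<lambda>i. normal_law (\<mu> i) \<sigma>)) \<phi>\<bar>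
    \<le> \<delta> * (sqrt (\<Sum>i\<in>I. (\<nu> i - \<mu> i)\<^sup>2) / (2 * \<sigma>))"
proof (cases "\<forall>i\<in>I. \<nu> i = \<mu> i")
  case True
  then have "PiM I (\<lambda>i. normal_law (\<nu> i) \<sigma>) = PiM I (\<lambda>i. normal_law (\<mu> i) \<sigma>)"
    by (intro PiM_cong) auto
  then show ?thesis using True by simp
next
  case False
  let ?P = "PiM I (\<lambda>i. normal_law (\<mu> i) \<sigma>)"
  let ?L = "\<lambda>x. \<Prod>i\<in>I. normal_ratio \<sigma> (\<mu> i) (\<nu> i) (x i)"
  interpret N: product_prob_space "\<lambda>i. normal_law (\<mu> i) \<sigma>" I
    using assms(1) by (intro product_prob_spaceI prob_space_normal_law)
  have sets [measurable_cong]: "sets ?P = sets (PiM I (\<lambda>_. borel))"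
    by (intro sets_PiM_cong) auto
  then have space: "space ?P = space (PiM I (\<lambda>_. borel))" by (rule sets_eq_imp_space_eq)
  have "PiM I (\<lambda>i. normal_law (\<nu> i) \<sigma>)
      = PiM I (\<lambda>i. density (normal_law (\<mu> i) \<sigma>) (\<lambda>x. ennreal (normal_ratio \<sigma> (\<mu> i) (\<nu> i) x)))"
    by (simp add: density_normal_ratio[OF assms(1)])
  also have "\<dots> = density ?P (\<lambda>x. \<Prod>i\<in>I. ennreal (normal_ratio \<sigma> (\<mu> i) (\<nu> i) (x i)))"
    using assms(1,2)
    by (intro PiM_density)
      (auto simp: density_normal_ratio intro!: prob_space_imp_sigma_finite prob_space_normal_law)
  also have "\<dots> = density ?P (\<lambda>x. ennreal (?L x))"
    by (simp add: prod_ennreal)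
  finally have dens: "PiM I (\<lambda>i. normal_law (\<nu> i) \<sigma>) = density ?P (\<lambda>x. ennreal (?L x))" .
  have [measurable]: "\<phi> \<in> borel_measurable ?P" by measurable
  have L [measurable]: "?L \<in> borel_measurable ?P" by measurable
  have eq: "integral\<^sup>L (PiM I (\<lambda>i. normal_law (\<nu> i) \<sigma>)) \<phi> = (\<integral>x. ?L x * \<phi> x \<partial>?P)"
    unfolding dens by (subst integral_density) (auto intro!: prod_nonneg)
  show ?thesis
    unfolding eq
  proof (rule N.integral_likelihood_diff_le[where a = a])
    show "integrable ?P ?L"
      using assms by (intro N.product_integrable_prod) (auto simp: integral_normal_ratio)
    show "integral\<^sup>L ?P ?L = 1"
      using assms by (subst N.product_integral_prod) (auto simp: integral_normal_ratio)
    have "(\<integral>x. sqrt (?L x) \<partial>?P) = (\<integral>x. (\<Prod>i\<in>I. sqrt (normal_ratio \<sigma> (\<mu> i) (\<nu> i) (x i))) \<partial>?P)"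
      using assms(2) by (simp add: sqrt_prod)
    also have "\<dots> = exp (- (\<Sum>i\<in>I. (\<nu> i - \<mu> i)\<^sup>2) / (8 * \<sigma>\<^sup>2))"
      using assms
      by (subst N.product_integral_prod)
        (auto simp: integral_sqrt_normal_ratio exp_sum sum_divide_distrib sum_negf[symmetric])
    finally show "1 - (\<integral>x. sqrt (?L x) \<partial>?P)\<^sup>2 \<le> (sqrt (\<Sum>i\<in>I. (\<nu> i - \<mu> i)\<^sup>2) / (2 * \<sigma>))\<^sup>2"
      using one_minus_normal_affinity_le[OF assms(1)] by (simp add: sum_nonneg)
    obtain j where "j \<in> I" "\<nu> j \<noteq> \<mu> j" using False by blast
    then have "0 < (\<Sum>i\<in>I. (\<nu> i - \<mu> i)\<^sup>2)"
      using assms(2) by (intro sum_pos2[where i = j]) auto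
    then show "0 < sqrt (\<Sum>i\<in>I. (\<nu> i - \<mu> i)\<^sup>2) / (2 * \<sigma>)" using assms(1) by simp
  qed (use bnd space in \<open>auto intro: prod_nonneg\<close>)
qed

text \<open>By Fubini, record \<open>i\<close> is integrated first with the others frozen;
  \<open>normal_law_diff_le\<close> bounds each slice and the bound survives averaging. The cost is
  the sensitivity \<open>\<delta>\<close> to one record times the statistical distance between its
  two laws.\<close>

lemma PiM_normal_law_change_one_le:
  fixes \<phi> :: "('i \<Rightarrow> real) \<Rightarrow> real"
  assumes "0 < \<sigma>" "finite I" "i \<in> I"
    and \<phi> [measurable]: "\<phi> \<in> borel_measurable (PiM I (\<lambda>_. borel))"
    and bnd: "\<And>x. x \<in> space (PiM I (\<lambda>_. borel)) \<Longrightarrow> \<bar>\<phi> x\<bar> \<le> C"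
    and osc: "\<And>x y z. x \<in> space (PiM (I - {i}) (\<lambda>_. borel)) \<Longrightarrow> \<phi> (x(i := y)) - \<phi> (x(i := z)) \<le> \<delta>"
    and eq: "\<And>j. j \<in> I - {i} \<Longrightarrow> \<nu> j = \<mu> j"
  shows "\<bar>integral\<^sup>L (PiM I (\<lambda>i. normal_law (\<nu> i) \<sigma>)) \<phi> - integral\<^sup>L (PiM I (\<lambda>i. normal_law (\<mu> i) \<sigma>)) \<phi>\<bar>
    \<le> \<delta> * (\<bar>\<nu> i - \<mu> i\<bar> / (2 * \<sigma>))"
proof -
  let ?J = "I - {i}"
  let ?PJ = "PiM ?J (\<lambda>i. normal_law (\<mu> i) \<sigma>)"
  have I: "I = insert i ?J" using assms(3) by blast
  have setsJ [measurable_cong]: "sets ?PJ = sets (PiM ?J (\<lambda>_. borel))"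
    by (intro sets_PiM_cong) auto
  then have spaceJ: "space ?PJ = space (PiM ?J (\<lambda>_. borel))" by (rule sets_eq_imp_space_eq)
  interpret N: product_prob_space "\<lambda>i. normal_law (\<mu> i) \<sigma>" ?J
    using assms(1) by (intro product_prob_spaceI prob_space_normal_law)
  \<comment> \<open>Stated for every \<open>\<theta>\<close> that agrees with \<open>\<mu>\<close>
    off \<open>i\<close>, so that the slices for \<open>\<nu>\<close> and \<open>\<mu>\<close> share
    the outer measure \<open>?PJ\<close> and can be subtracted under one integral.\<close>
  have slice: "integral\<^sup>L (PiM I (\<lambda>i. normal_law (\<theta> i) \<sigma>)) \<phi>
        = (\<integral>x. (\<integral>y. \<phi> (x(i := y)) \<partial>normal_law (\<theta> i) \<sigma>) \<partial>?PJ)"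
      and slice_integrable: "integrable ?PJ (\<lambda>x. \<integral>y. \<phi> (x(i := y)) \<partial>normal_law (\<theta> i) \<sigma>)"
    if "\<And>j. j \<in> ?J \<Longrightarrow> \<theta> j = \<mu> j" for \<theta>
  proof -
    interpret T: product_prob_space "\<lambda>i. normal_law (\<theta> i) \<sigma>" I
      using assms(1) by (intro product_prob_spaceI prob_space_normal_law)
    let ?P = "PiM I (\<lambda>i. normal_law (\<theta> i) \<sigma>)"
    have sets [measurable_cong]: "sets ?P = sets (PiM I (\<lambda>_. borel))"
      by (intro sets_PiM_cong) auto
    then have space: "space ?P = space (PiM I (\<lambda>_. borel))" by (rule sets_eq_imp_space_eq)
    have "integrable ?P \<phi>"
      using bnd space by (intro T.integrable_const_bound[where B = C] AE_I2) auto
    then have "integral\<^sup>L ?P \<phi>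
        = (\<integral>x. (\<integral>y. \<phi> (x(i := y)) \<partial>normal_law (\<theta> i) \<sigma>) \<partial>PiM ?J (\<lambda>i. normal_law (\<theta> i) \<sigma>))"
      using T.product_integral_insert[of ?J i \<phi>] assms(2) I[symmetric] by simp
    moreover have "PiM ?J (\<lambda>i. normal_law (\<theta> i) \<sigma>) = ?PJ"
      using that by (intro PiM_cong) auto
    ultimately show "integral\<^sup>L ?P \<phi> = (\<integral>x. (\<integral>y. \<phi> (x(i := y)) \<partial>normal_law (\<theta> i) \<sigma>) \<partial>?PJ)"
      by simp
    have upd: "(\<lambda>(x, y). x(i := y)) \<in> PiM ?J (\<lambda>_. borel) \<Otimes>\<^sub>M borel \<rightarrow>\<^sub>M PiM I (\<lambda>_. borel :: real measure)"
      using measurable_add_dim[of i ?J "\<lambda>_. borel :: real measure"] I[symmetric] by simp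
    have [measurable]: "(\<lambda>(x, y). \<phi> (x(i := y))) \<in> borel_measurable (PiM ?J (\<lambda>_. borel) \<Otimes>\<^sub>M borel)"
      using measurable_compose[OF upd \<phi>] by (simp add: split_beta')
    have "\<bar>\<integral>y. \<phi> (x(i := y)) \<partial>normal_law (\<theta> i) \<sigma>\<bar> \<le> C" if "x \<in> space (PiM ?J (\<lambda>_. borel))" for x
    proof -
      have x: "x(i := y) \<in> space (PiM I (\<lambda>_. borel))" for y :: real
        using that assms(3) by (auto simp: space_PiM PiE_def extensional_def)
      have "integrable (normal_law (\<theta> i) \<sigma>) (\<lambda>y. \<phi> (x(i := y)))"
        using bnd[OF x] that by (intro T.M.integrable_const_bound[where B = C] AE_I2) auto
      then have "\<bar>\<integral>y. \<phi> (x(i := y)) \<partial>normal_law (\<theta> i) \<sigma>\<bar> \<le> (\<integral>y. C \<partial>normal_law (\<theta> i) \<sigma>)"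
        using bnd[OF x]
        by (intro order_trans[OF integral_abs_bound] integral_mono) auto
      then show ?thesis using T.M.prob_space[of i] by simp
    qed
    then show "integrable ?PJ (\<lambda>x. \<integral>y. \<phi> (x(i := y)) \<partial>normal_law (\<theta> i) \<sigma>)"
      using spaceJ by (intro N.integrable_const_bound[where B = C] AE_I2) auto
  qed
  let ?h = "\<lambda>\<theta> x. \<integral>y. \<phi> (x(i := y)) \<partial>normal_law (\<theta> i) \<sigma>"
  have int: "integrable ?PJ (?h \<nu>)" "integrable ?PJ (?h \<mu>)" using slice_integrable eq by blast+
  have "\<bar>integral\<^sup>L (PiM I (\<lambda>i. normal_law (\<nu> i) \<sigma>)) \<phi> - integral\<^sup>L (PiM I (\<lambda>i. normal_law (\<mu> i) \<sigma>)) \<phi>\<bar>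
      = \<bar>\<integral>x. ?h \<nu> x - ?h \<mu> x \<partial>?PJ\<bar>"
    using slice[of \<nu>] slice[of \<mu>] eq int by simp
  also have "\<dots> \<le> (\<integral>x. \<delta> * (\<bar>\<nu> i - \<mu> i\<bar> / (2 * \<sigma>)) \<partial>?PJ)"
  proof (rule order_trans[OF integral_abs_bound integral_mono])
    fix x assume "x \<in> space ?PJ"
    then have x: "x \<in> space (PiM ?J (\<lambda>_. borel))" by (simp add: spaceJ)
    have "(\<lambda>y. x(i := y)) \<in> borel \<rightarrow>\<^sub>M PiM I (\<lambda>_. borel :: real measure)"
      using measurable_compose[OF measurable_Pair1'[OF x] measurable_add_dim[of i]] assms(3)
      by (simp add: insert_absorb)
    then have "(\<lambda>y. \<phi> (x(i := y))) \<in> borel_measurable borel"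
      using \<phi> by (rule measurable_compose)
    then show "\<bar>?h \<nu> x - ?h \<mu> x\<bar> \<le> \<delta> * (\<bar>\<nu> i - \<mu> i\<bar> / (2 * \<sigma>))"
      using osc[OF x] by (intro normal_law_diff_le assms(1))
  qed (use int in auto)
  finally show ?thesis by (simp add: N.P.prob_space)
qed

section \<open>Private mechanisms under two candidate means\<close>

text \<open>Neighbourhood is symmetric, so privacy applies to \<open>A\<close> from \<open>D\<close>
  to \<open>D'\<close> and to its complement from \<open>D'\<close> to \<open>D\<close>, as
  \<open>indistinguishable_imp_diff_le\<close> requires.\<close>

lemma PDP_mechanism_diff_le:
  assumes M: "M \<in> PDP_mechanisms n \<epsilon> R" and "i \<in> {1..n}" "0 \<le> \<epsilon> i" "neighbours n i D D'"
    and A: "A \<in> sets R"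
  shows "measure (M D) A - measure (M D') A \<le> \<epsilon> i / 2"
proof -
  have neigh: "neighbours n i D' D" and D: "D \<in> space (data_space n)" "D' \<in> space (data_space n)"
    using assms(4) by (auto simp: neighbours_def)
  have kernel: "M \<in> data_space n \<rightarrow>\<^sub>M prob_algebra R"
    using M by (simp add: PDP_mechanisms_def mechanisms_def)
  have prob: "prob_space (M E)" "sets (M E) = sets R" if "E \<in> space (data_space n)" for E
    using measurable_space[OF kernel that] by (auto simp: space_prob_algebra)
  have compl: "measure (M E) (space R - A) = 1 - measure (M E) A"
    if "E \<in> space (data_space n)" for E
    using prob_space.prob_compl[OF prob(1)[OF that], of A] prob(2)[OF that]
      sets_eq_imp_space_eq[OF prob(2)[OF that]] A by simp
  have pdp: "measure (M E) K \<le> exp (\<epsilon> i) * measure (M E') K"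
    if "neighbours n i E E'" "K \<in> sets R" for E E' K
    using M assms(2) that by (auto simp: PDP_mechanisms_def)
  show ?thesis
    using pdp[OF assms(4) A] pdp[OF neigh, of "space R - A"] A compl D assms(3)
    by (intro indistinguishable_imp_diff_le) auto
qed

text \<open>
  Le Cam's two-point method with means \<open>0\<close> and \<open>2t\<close>: the first \<open>k\<close> records are moved one at a
  time, which privacy makes cheap, and the other \<open>n - k\<close> all at once, at the
  statistical cost of their joint total variation distance.
\<close>

lemma PDP_mechanism_two_point:
  fixes M :: "(nat \<Rightarrow> real) \<Rightarrow> real measure"
  assumes M: "M \<in> PDP_mechanisms n \<epsilon> R"
    and \<sigma>: "0 < \<sigma>" and \<epsilon>: "\<And>i. i \<in> {1..n} \<Longrightarrow> 0 \<le> \<epsilon> i"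
    and A: "A \<in> sets R" and k: "k \<le> n" and t: "0 \<le> t"
  shows "\<bar>(\<integral>D. measure (M D) A \<partial>iid_normal n (2 * t) \<sigma>) - (\<integral>D. measure (M D) A \<partial>iid_normal n 0 \<sigma>)\<bar>
    \<le> t / (2 * \<sigma>) * ((\<Sum>i=1..k. \<epsilon> i) + 2 * sqrt (real (n - k)))"
proof -
  define g where "g D = measure (M D) A" for D
  \<comment> \<open>Hybrid mean vectors: records \<open>1..j\<close> have mean \<open>2 * t\<close>,
    the rest mean 0. \<open>E 0\<close> and \<open>E n\<close> are the two i.i.d. models, and
    \<open>E j\<close> and \<open>E (Suc j)\<close> differ only in the law of record
    \<open>Suc j\<close>.\<close>
  define m where "m j i = (if i \<le> j then 2 * t else 0)" for i j :: nat
  define E where "E j = integral\<^sup>L (PiM {1..n} (\<lambda>i. normal_law (m j i) \<sigma>)) g" for j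
  have kernel: "M \<in> PiM {1..n} (\<lambda>_. borel) \<rightarrow>\<^sub>M prob_algebra R"
    using M by (simp add: PDP_mechanisms_def mechanisms_def data_space_def)
  have g [measurable]: "g \<in> borel_measurable (PiM {1..n} (\<lambda>_. borel))"
    unfolding g_def using measurable_compose[OF kernel measurable_measure_prob_algebra[OF A]] .
  have g01: "0 \<le> g D \<and> g D \<le> 1" if "D \<in> space (PiM {1..n} (\<lambda>_. borel))" for D
    using measurable_space[OF kernel that]
    by (auto simp: g_def space_prob_algebra intro: prob_space.prob_le_1)
  have step: "\<bar>E (Suc j) - E j\<bar> \<le> \<epsilon> (Suc j) * (t / (2 * \<sigma>))" if j: "Suc j \<le> n" for j
  proof -
    have "\<bar>E (Suc j) - E j\<bar> \<le> \<epsilon> (Suc j) / 2 * (\<bar>m (Suc j) (Suc j) - m j (Suc j)\<bar> / (2 * \<sigma>))"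
      unfolding E_def
    proof (rule PiM_normal_law_change_one_le[where C = 1])
      fix x :: "nat \<Rightarrow> real" and y z
      assume x: "x \<in> space (PiM ({1..n} - {Suc j}) (\<lambda>_. borel))"
      have "x(Suc j := y) \<in> space (data_space n)" for y
        using x j by (auto simp: data_space_def space_PiM PiE_def extensional_def)
      then have "neighbours n (Suc j) (x(Suc j := y)) (x(Suc j := z))"
        by (simp add: neighbours_def)
      then show "g (x(Suc j := y)) - g (x(Suc j := z)) \<le> \<epsilon> (Suc j) / 2"
        unfolding g_def using j by (intro PDP_mechanism_diff_le[OF M _ _ _ A] \<epsilon>) auto
    qed (use \<sigma> j g g01 in \<open>auto simp: m_def\<close>)
    then show ?thesis using t by (simp add: m_def)
  qed
  have "j \<le> n \<Longrightarrow> \<bar>E j - E 0\<bar> \<le> t / (2 * \<sigma>) * (\<Sum>i=1..j. \<epsilon> i)" for j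
  proof (induction j)
    case (Suc j)
    then have "\<bar>E j - E 0\<bar> \<le> t / (2 * \<sigma>) * (\<Sum>i=1..j. \<epsilon> i)" by simp
    with step[OF Suc.prems] show ?case
      by (simp add: distrib_left mult.commute)
  qed simp
  then have change_k: "\<bar>E k - E 0\<bar> \<le> t / (2 * \<sigma>) * (\<Sum>i=1..k. \<epsilon> i)" using k by blast
  have "\<bar>E n - E k\<bar> \<le> 1 * (sqrt (\<Sum>i\<in>{1..n}. (m n i - m k i)\<^sup>2) / (2 * \<sigma>))"
    unfolding E_def using \<sigma> g g01 by (intro PiM_normal_law_diff_le[where a = 0]) auto
  \<comment> \<open>Only the records after \<open>k\<close> still move, each by
    \<open>2 * t\<close>. The test function takes values in \<open>[0, 1]\<close>, hence the
    oscillation 1 in front.\<close>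
  also have "(\<Sum>i\<in>{1..n}. (m n i - m k i)\<^sup>2) = (\<Sum>i\<in>{Suc k..n}. (2 * t)\<^sup>2)"
    by (rule sum.mono_neutral_cong_right) (auto simp: m_def)
  also have "\<dots> = (2 * t)\<^sup>2 * real (n - k)" by simp
  also have "1 * (sqrt \<dots> / (2 * \<sigma>)) = t / (2 * \<sigma>) * (2 * sqrt (real (n - k)))"
    using t by (simp add: real_sqrt_mult)
  finally have "\<bar>E n - E 0\<bar> \<le> t / (2 * \<sigma>) * ((\<Sum>i=1..k. \<epsilon> i) + 2 * sqrt (real (n - k)))"
    using change_k by (simp add: distrib_left)
  moreover have "E n = (\<integral>D. g D \<partial>iid_normal n (2 * t) \<sigma>)"
    unfolding E_def iid_normal_def
    by (intro arg_cong2[where f = "integral\<^sup>L"] PiM_cong) (auto simp: m_def)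
  moreover have "E 0 = (\<integral>D. g D \<partial>iid_normal n 0 \<sigma>)"
    unfolding E_def iid_normal_def
    by (intro arg_cong2[where f = "integral\<^sup>L"] PiM_cong) (auto simp: m_def)
  ultimately show ?thesis by (simp add: g_def)
qed

section \<open>Output laws and the minimax lower bound\<close>

lemma iid_normal_in_prob_algebra:
  assumes "0 < \<sigma>"
  shows "iid_normal n \<mu> \<sigma> \<in> space (prob_algebra (data_space n))"
  using assms unfolding iid_normal_def data_space_def space_prob_algebra
  by (auto intro!: sets_PiM_cong prob_space_PiM prob_space_normal_law)

lemma output_law_iid_normal:
  assumes \<sigma>: "0 < \<sigma>" and M: "M \<in> mechanisms n R"
  shows "prob_space (output_law (iid_normal n \<mu> \<sigma>) M)"
    and "sets (output_law (iid_normal n \<mu> \<sigma>) M) = sets R"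
    and "A \<in> sets R \<Longrightarrow> measure (output_law (iid_normal n \<mu> \<sigma>) M) A = (\<integral>D. measure (M D) A \<partial>iid_normal n \<mu> \<sigma>)"
proof -
  let ?P = "iid_normal n \<mu> \<sigma>"
  have kernel: "M \<in> data_space n \<rightarrow>\<^sub>M prob_algebra R" using M by (simp add: mechanisms_def)
  have P: "?P \<in> space (prob_algebra (data_space n))" using \<sigma> by (rule iid_normal_in_prob_algebra)
  then interpret P: prob_space ?P by (simp add: space_prob_algebra)
  have sets: "sets ?P = sets (data_space n)" using P by (simp add: space_prob_algebra)
  have space: "space ?P = space (data_space n)" by (rule sets_eq_imp_space_eq[OF sets])
  have kernelP: "M \<in> ?P \<rightarrow>\<^sub>M prob_algebra R"
    using kernel by (simp cong: measurable_cong_sets add: sets)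
  show "prob_space (output_law ?P M)" "sets (output_law ?P M) = sets R"
    unfolding output_law_def by (rule prob_space_bind'[OF P kernel], rule sets_bind'[OF P kernel])
  have prob: "prob_space (M D)" if "D \<in> space ?P" for D
    using measurable_space[OF kernelP that] by (simp add: space_prob_algebra)
  assume A: "A \<in> sets R"
  have int: "integrable ?P (\<lambda>D. measure (M D) A)"
    using measurable_compose[OF kernelP measurable_measure_prob_algebra[OF A]] prob
    by (intro P.integrable_const_bound[where B = 1] AE_I2) (auto intro: prob_space.prob_le_1)
  have "emeasure (output_law ?P M) A = (\<integral>\<^sup>+D. emeasure (M D) A \<partial>?P)"
    unfolding output_law_def by (rule emeasure_bind_prob_algebra[OF P kernel A])
  also have "\<dots> = (\<integral>\<^sup>+D. ennreal (measure (M D) A) \<partial>?P)"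
    using prob by (intro nn_integral_cong finite_measure.emeasure_eq_measure prob_space.finite_measure)
  also have "\<dots> = ennreal (\<integral>D. measure (M D) A \<partial>?P)"
    using int by (intro nn_integral_eq_integral) auto
  finally show "measure (output_law ?P M) A = (\<integral>D. measure (M D) A \<partial>?P)"
    by (simp add: measure_def)
qed

theorem theorem5:
  fixes n :: nat and \<sigma> :: real and \<epsilon> :: "nat \<Rightarrow> real"
  assumes "n \<ge> 1"
    and "\<sigma> > 0"
    and "\<And>i. i \<in> {1..n} \<Longrightarrow> 0 \<le> \<epsilon> i"
    and "mono_on {1..n} \<epsilon>"
  shows "(INF M \<in> PDP_mechanisms n \<epsilon> (borel :: real measure).
            SUP \<mu> :: real.
              emeasure (output_law (iid_normal n \<mu> \<sigma>) M)
                {y. \<bar>y - \<mu>\<bar> \<ge> error_threshold n \<sigma> \<epsilon>}) \<ge> (1 / 4 :: ennreal)"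
proof (rule INF_greatest)
  fix M :: "(nat \<Rightarrow> real) \<Rightarrow> real measure"
  assume M: "M \<in> PDP_mechanisms n \<epsilon> borel"
  then have mech: "M \<in> mechanisms n borel" by (simp add: PDP_mechanisms_def)
  define t where "t = error_threshold n \<sigma> \<epsilon>"
  define Q where "Q \<mu> = output_law (iid_normal n \<mu> \<sigma>) M" for \<mu>
  define d where "d k = (\<Sum>i=1..k. \<epsilon> i) + 2 * sqrt (real (n - k))" for k
  note Q = output_law_iid_normal[OF assms(2) mech, folded Q_def]
  \<comment> \<open>The maximum is attained, so the two-point bound can be used with the very
    \<open>k\<close> that defines the threshold.\<close>
  have "t \<in> (\<lambda>k. 1 / sqrt 2 * (\<sigma> / d k)) ` {1..n}"
    unfolding t_def error_threshold_def d_def using assms(1) by (intro Max_in) auto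
  then obtain k where k: "k \<in> {1..n}" "t = 1 / sqrt 2 * (\<sigma> / d k)" by blast
  have d: "0 \<le> d k" unfolding d_def using assms(3) k(1) by (auto intro!: add_nonneg_nonneg sum_nonneg)
  have t: "0 \<le> t" using k(2) d assms(2) by simp
  \<comment> \<open>For \<open>d k \<noteq> 0\<close> the factor \<open>1 / sqrt 2\<close> in the
    threshold yields \<open>1 / (2 * sqrt 2)\<close>; the weaker \<open>1 / 2\<close> already leaves
    room for an error probability of 1/4.\<close>
  have "t / (2 * \<sigma>) * d k \<le> 1 / 2"
  proof (cases "d k = 0")
    case False
    then have "t / (2 * \<sigma>) * d k = 1 / (2 * sqrt 2)"
      using assms(2) by (simp add: k(2))
    also have "\<dots> \<le> 1 / 2" by (simp add: divide_simps)
    finally show ?thesis .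
  qed simp
  \<comment> \<open>The event that the output is closer than \<open>t\<close> to the mean 0. Every
    such output is at distance at least \<open>t\<close> from \<open>2 * t\<close>, so
    \<open>A\<close> is contained in the error event \<open>F (2 * t)\<close>.\<close>
  define A where "A = {y::real. \<bar>y\<bar> < t}"
  define F where "F \<mu> = {y::real. \<bar>y - \<mu>\<bar> \<ge> t}" for \<mu>
  have [measurable]: "A \<in> sets borel" "F \<mu> \<in> sets borel" for \<mu>
    by (auto simp: A_def F_def)
  interpret Q: prob_space "Q \<mu>" for \<mu> by (rule Q(1))
  have sets: "sets (Q \<mu>) = sets borel" for \<mu> by (rule Q(2))
  have "\<bar>measure (Q (2 * t)) A - measure (Q 0) A\<bar> \<le> t / (2 * \<sigma>) * d k"
    using PDP_mechanism_two_point[OF M assms(2,3), of A k t] k(1) t by (simp add: Q(3) d_def)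
  also note \<open>t / (2 * \<sigma>) * d k \<le> 1 / 2\<close>
  finally have close: "measure (Q 0) A - measure (Q (2 * t)) A \<le> 1 / 2" by linarith
  have "F 0 = space (Q 0) - A"
    using sets_eq_imp_space_eq[OF sets, of 0] by (auto simp: F_def A_def)
  then have "measure (Q 0) (F 0) = 1 - measure (Q 0) A"
    using Q.prob_compl[of A 0] by (simp add: sets)
  moreover have "measure (Q (2 * t)) A \<le> measure (Q (2 * t)) (F (2 * t))"
    by (rule Q.finite_measure_mono) (auto simp: sets A_def F_def)
  \<comment> \<open>The two error probabilities sum to at least
    \<open>1 - measure (Q 0) A + measure (Q (2 * t)) A\<close>, hence to at least 1/2, so one of
    them reaches 1/4.\<close>
  ultimately have "1 / 4 \<le> measure (Q 0) (F 0) \<or> 1 / 4 \<le> measure (Q (2 * t)) (F (2 * t))"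
    using close by linarith
  then obtain \<mu> where "1 / 4 \<le> measure (Q \<mu>) (F \<mu>)" by blast
  then have "ennreal (1 / 4) \<le> emeasure (Q \<mu>) (F \<mu>)"
    by (simp add: Q.emeasure_eq_measure ennreal_leI)
  also have "ennreal (1 / 4) = 1 / 4"
    by (metis divide_ennreal ennreal_1 ennreal_numeral zero_le_numeral zero_le_one zero_less_numeral)
  finally have "1 / 4 \<le> emeasure (Q \<mu>) (F \<mu>)" .
  also have "\<dots> \<le> (SUP \<mu>. emeasure (Q \<mu>) (F \<mu>))" by (rule SUP_upper) simp
  finally show "1 / 4 \<le> (SUP \<mu>. emeasure (output_law (iid_normal n \<mu> \<sigma>) M)
      {y. \<bar>y - \<mu>\<bar> \<ge> error_threshold n \<sigma> \<epsilon>})"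
    by (simp add: Q_def F_def t_def)
qed

end
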